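(* There exists an inter-class orthogonal plan for a $3^4$ experiment on eighteen blocks of size four each estimating all main effects and all two-factor interactions.
   Context: $F=\{0,1,2\}$ is the field of order $3$. A run of a $3^m$ experiment is a vector $x\in F^m$ ($x_i$ is the level of the $i$th factor). A plan consists of a list of blocks, each a list of runs. For $a\in F^m\setminus\{0\}$, $E_a$ denotes the factorial effect given by $a$, with $E_a=E_{2a}$; run $x$ is at level $t$ of $E_a$ if $a'x=t$. $E_a$ is a main effect if $a$ has exactly one non-zero entry, and a two-factor interaction if $a$ has exactly two non-zero entries (so $A_iA_j$ and $A_iA_j^2$ count as two different two-factor interactions, each with 2 degrees of freedom). All interactions involving three or more factors are assumed absent. Orthogonality through the block factor (all blocks of size $k$): $E_a$ and $E_b$ are orthogonal if $kN^{ab}=L^a(L^b)'$, where $N^{ab}$ has $(\alpha,\beta)$ entry the number of runs $x$ of the plan with $a'x=\alpha$, $b'x=\beta$, and $L^a$ has $(\alpha,j)$ entry the number of runs $x$ in block $j$ with $a'x=\alpha$. A plan is inter-class orthogonal if the set of all effects of interest (here: all main effects and two-factor interactions) can be divided into several classes such that every effect is orthogonal (through the block factor) to every effect from a different class. A plan estimates a set $S$ of effects if, in the linear model in which the expected response of a run $x$ in block $j$ is $\mu+\beta_j+\sum_{E_a\in S}\theta^a_{a'x}$ (general effect, block effects, and effects of the levels of the members of $S$), every contrast $\sum_{t\in F} l_t\theta^a_t$ with $\sum_t l_t=0$, $E_a\in S$, is estimable. *)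

theory Defs
  imports "HOL-Analysis.Finite_Cartesian_Product" "HOL-Library.Numeral_Type"
    "HOL-Library.Disjoint_Sets"
begin

text \<open>
  The numeral type \<^typ>\<open>3\<close> carries arithmetic modulo 3, so it is the field F of order 3.  The
  factors are indexed by a finite type and a run is a vector over F.  Blocks and plans are lists:
  a run may occur more than once, and counts are taken with multiplicity.
\<close>

type_synonym 'm run = "3 ^ 'm"
type_synonym 'm block = "'m run list"
type_synonym 'm plan = "'m block list"

text \<open>
  The effect given by \<open>a\<close> is represented by the set of the two vectors that give it, so that
  \<open>effect a = effect (2a)\<close>.
\<close>

definition effect :: "3 ^ 'm \<Rightarrow> (3 ^ 'm) set"
  where "effect a = {a, 2 *s a}"

definition main_effects :: "(3 ^ 'm) set set"
  where "main_effects = {effect a |a. card {i. a $ i \<noteq> 0} = 1}"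

definition two_factor_interactions :: "(3 ^ 'm) set set"
  where "two_factor_interactions = {effect a |a. card {i. a $ i \<noteq> 0} = 2}"

definition N_entry :: "'m plan \<Rightarrow> 3 ^ 'm \<Rightarrow> 3 ^ 'm \<Rightarrow> 3 \<Rightarrow> 3 \<Rightarrow> nat"
  where "N_entry P a b \<alpha> \<beta> =
    length (filter (\<lambda>x. scalar_product a x = \<alpha> \<and> scalar_product b x = \<beta>) (concat P))"

definition L_entry :: "'m plan \<Rightarrow> 3 ^ 'm \<Rightarrow> 3 \<Rightarrow> nat \<Rightarrow> nat"
  where "L_entry P a \<alpha> j = length (filter (\<lambda>x. scalar_product a x = \<alpha>) (P ! j))"

text \<open>
  The equation \<open>k N = L L'\<close>, entry by entry, where \<open>k\<close> is the common block size.  Replacing \<open>a\<close>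
  by \<open>2a\<close> only permutes the rows of \<open>N\<close> and \<open>L\<close> (and likewise for \<open>b\<close>), so quantifying over all
  representatives of the two effects agrees with choosing any one of each.
\<close>

definition orthogonal_effects :: "nat \<Rightarrow> 'm plan \<Rightarrow> (3 ^ 'm) set \<Rightarrow> (3 ^ 'm) set \<Rightarrow> bool"
  where "orthogonal_effects k P A B \<longleftrightarrow> (\<forall>a\<in>A. \<forall>b\<in>B. \<forall>\<alpha> \<beta>.
    k * N_entry P a b \<alpha> \<beta> = (\<Sum>j<length P. L_entry P a \<alpha> j * L_entry P b \<beta> j))"

text \<open>
  At least two classes are required: with a single class the condition would be void.
\<close>

definition inter_class_orthogonal :: "nat \<Rightarrow> 'm plan \<Rightarrow> (3 ^ 'm) set set \<Rightarrow> bool"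
  where "inter_class_orthogonal k P S \<longleftrightarrow> (\<exists>\<C>. partition_on S \<C> \<and> 2 \<le> card \<C> \<and>
    (\<forall>C\<in>\<C>. \<forall>D\<in>\<C>. C \<noteq> D \<longrightarrow> (\<forall>A\<in>C. \<forall>B\<in>D. orthogonal_effects k P A B)))"

text \<open>
  In the linear model, \<open>r A\<close> is the representative of the effect \<open>A\<close> that labels its levels: run
  \<open>x\<close> is at the level \<open>(r A)'x\<close>.  The parameters are the general effect \<open>\<mu>\<close>, the block effects
  \<open>\<beta> j\<close> and the effects \<open>\<theta> A t\<close> of the levels of the members of \<open>S\<close>.
\<close>

definition expected_response ::
    "(3 ^ 'm) set set \<Rightarrow> ((3 ^ 'm) set \<Rightarrow> 3 ^ 'm) \<Rightarrow>
     real \<Rightarrow> (nat \<Rightarrow> real) \<Rightarrow> ((3 ^ 'm) set \<Rightarrow> 3 \<Rightarrow> real) \<Rightarrow> nat \<Rightarrow> 'm run \<Rightarrow> real"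
  where "expected_response S r \<mu> \<beta> \<theta> j x =
    \<mu> + \<beta> j + (\<Sum>A\<in>S. \<theta> A (scalar_product (r A) x))"

text \<open>
  A parametric function is estimable if it has a linear unbiased estimator.  Here \<open>c j i\<close> is the
  coefficient of the response of the \<open>i\<close>-th run in block \<open>j\<close>.
\<close>

definition estimable ::
    "'m plan \<Rightarrow> (3 ^ 'm) set set \<Rightarrow> ((3 ^ 'm) set \<Rightarrow> 3 ^ 'm) \<Rightarrow>
     (real \<Rightarrow> (nat \<Rightarrow> real) \<Rightarrow> ((3 ^ 'm) set \<Rightarrow> 3 \<Rightarrow> real) \<Rightarrow> real) \<Rightarrow> bool"
  where "estimable P S r \<psi> \<longleftrightarrow> (\<exists>c. \<forall>\<mu> \<beta> \<theta>.
    (\<Sum>j<length P. \<Sum>i<length (P ! j). c j i * expected_response S r \<mu> \<beta> \<theta> j (P ! j ! i))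
      = \<psi> \<mu> \<beta> \<theta>)"

text \<open>
  Another choice of representatives only relabels the levels, so requiring estimability for every
  choice \<open>r\<close> agrees with requiring it for one.
\<close>

definition estimates :: "'m plan \<Rightarrow> (3 ^ 'm) set set \<Rightarrow> bool"
  where "estimates P S \<longleftrightarrow> (\<forall>r. (\<forall>A\<in>S. r A \<in> A) \<longrightarrow>
    (\<forall>A\<in>S. \<forall>l :: 3 \<Rightarrow> real. (\<Sum>t\<in>UNIV. l t) = 0 \<longrightarrow>
      estimable P S r (\<lambda>\<mu> \<beta> \<theta>. \<Sum>t\<in>UNIV. l t * \<theta> A t)))"

end

theory Submission
  imports Defs "HOL-Analysis.Cartesian_Space"
begin

text \<open>
  Let \<open>H\<close> be the plane spanned by \<open>(1,1,1,0)\<close> and \<open>(0,1,2,1)\<close>, the self-dual tetracode of minimum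
  distance 3.  The plan consists of all translates under \<open>H\<close> of the two initial blocks
  \<open>{0, e\<^sub>1, 2e\<^sub>1, e\<^sub>3}\<close> and \<open>{0, e\<^sub>2, 2e\<^sub>2, e\<^sub>4}\<close>.  If the restrictions of \<open>a\<close> and \<open>b\<close> to \<open>H\<close>
  are linearly independent, then \<open>h \<mapsto> (a'h, b'h)\<close> is a bijection and \<open>E\<^sub>a\<close> and \<open>E\<^sub>b\<close> are orthogonal
  whatever the initial blocks are.  No low-order effect vanishes on \<open>H\<close>, so the classes are the four
  points of the projective line of functionals on \<open>H\<close>.

  To estimate \<open>E\<^sub>a\<close>, give the run \<open>x + h\<close> a coefficient that depends only on \<open>x\<close> and \<open>a'h\<close> and whose
  sum over each block vanishes.  Effects of the other classes then drop out, and each class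
  consists of one main effect and three interactions.  Within a class, the lines \<open>{0, e\<^sub>i, 2e\<^sub>i}\<close>,
  \<open>i = 1, 2\<close>, isolate the effects involving factor 1 or 2.  The differences along \<open>e\<^sub>3\<close> and \<open>e\<^sub>4\<close>
  give the main effects of factors 3 and 4, and the one along \<open>e\<^sub>3\<close> also gives the interactions of
  these two factors after one of the effects isolated before has been eliminated.
\<close>

section \<open>Arithmetic modulo 3 and representatives of effects\<close>

lemma three_cases: "x = 0 \<or> x = 1 \<or> x = 2" for x :: 3
  using exhaust_3[of x] by auto

lemma sum_UNIV_3: "(\<Sum>t\<in>UNIV. f t) = f 0 + f 1 + f 2" for f :: "3 \<Rightarrow> 'a::comm_monoid_add"
proof -
  have "UNIV = {0, 1, 2 :: 3}"
    using three_cases by auto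
  then have "sum f UNIV = sum f {0, 1, 2}"
    by (rule arg_cong)
  then show ?thesis
    by (simp add: add.assoc)
qed

text \<open>Case analyses over F leave literals such as 4 or -1; these equations bring them back to
  0, 1, 2.\<close>

lemma numerals_3: "(3 :: 3) = 0" "(4 :: 3) = 1" "(5 :: 3) = 2" "(6 :: 3) = 0" "(8 :: 3) = 2"
  "(- 1 :: 3) = 2" "(- 2 :: 3) = 1"
  by simp_all

lemma square_eq_1_3: "x \<noteq> 0 \<Longrightarrow> x * x = 1" for x :: 3
  using three_cases[of x] by auto

lemma scalar_product_add: "scalar_product a (x + y) = scalar_product a x + scalar_product a y"
  by (simp add: scalar_product_def distrib_left sum.distrib)

lemma scalar_product_smult: "scalar_product a (c *s x) = c * scalar_product a x"
  for a x :: "3 ^ 'm"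
  by (simp add: scalar_product_def sum_distrib_left algebra_simps)

lemma smult_scalar_product: "scalar_product (c *s a) x = c * scalar_product a x"
  for a x :: "3 ^ 'm"
  by (simp add: scalar_product_def sum_distrib_left algebra_simps)

lemma double_double_vec [simp]: "2 *s (2 *s a) = a" for a :: "3 ^ 'm"
  by (simp add: vec_eq_iff numerals_3)

lemma in_effect_iff: "b \<in> effect a \<longleftrightarrow> effect b = effect a"
  by (auto simp: effect_def doubleton_eq_iff)

section \<open>Functionals restricted to a plane\<close>

text \<open>The restriction of the functional \<open>a'\<close> to the span of \<open>u\<close> and
  \<open>v\<close>, encoded by its values on these generators.\<close>

definition slope :: "3 ^ 'm \<Rightarrow> 3 ^ 'm \<Rightarrow> 3 ^ 'm \<Rightarrow> 3 \<times> 3"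
  where "slope u v a = (scalar_product a u, scalar_product a v)"

definition det2 :: "3 \<times> 3 \<Rightarrow> 3 \<times> 3 \<Rightarrow> 3"
  where "det2 z w = fst z * snd w - snd z * fst w"

text \<open>Two dependent non-zero pairs are proportional, and the only non-zero scalars of F are 1
  and 2.\<close>

lemma det2_eq_0:
  assumes "det2 z w = 0" "z \<noteq> 0" "w \<noteq> 0"
  shows "w = z \<or> w = (2 * fst z, 2 * snd z)"
proof -
  obtain a b c d where zw: "z = (a, b)" "w = (c, d)"
    by (cases z, cases w)
  show ?thesis
    using three_cases[of a] three_cases[of b] three_cases[of c] three_cases[of d] assms
    unfolding zw det2_def zero_prod_def by (elim disjE) (simp_all add: numerals_3)
qed

definition shift :: "3 ^ 'm \<Rightarrow> 3 ^ 'm \<Rightarrow> 3 \<times> 3 \<Rightarrow> 3 ^ 'm"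
  where "shift u v h = fst h *s u + snd h *s v"

lemma scalar_product_shift:
  "scalar_product a (shift u v h) = fst h * fst (slope u v a) + snd h * snd (slope u v a)"
  by (simp add: shift_def slope_def scalar_product_add scalar_product_smult)

text \<open>The map from \<open>h\<close> to the pair of values of \<open>a'\<close> and
  \<open>b'\<close> at \<open>shift u v h\<close> is linear with non-zero determinant, hence a
  bijection of \<open>3 \<times> 3\<close>.\<close>

lemma sum_shift_independent:
  fixes F :: "3 \<Rightarrow> 3 \<Rightarrow> 'c::comm_monoid_add"
  assumes "det2 (slope u v a) (slope u v b) \<noteq> 0"
  shows "(\<Sum>h\<in>UNIV. F (scalar_product a (shift u v h)) (scalar_product b (shift u v h)))
    = (\<Sum>s\<in>UNIV. \<Sum>t\<in>UNIV. F s t)"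
proof -
  obtain \<alpha> \<beta> \<gamma> \<delta> where ab: "slope u v a = (\<alpha>, \<beta>)" "slope u v b = (\<gamma>, \<delta>)"
    by fastforce
  define d where "d = \<alpha> * \<delta> - \<beta> * \<gamma>"
  have dd: "d * d = 1"
    using assms by (intro square_eq_1_3) (simp add: d_def det2_def ab)
  have "(\<Sum>h\<in>UNIV. F (scalar_product a (shift u v h)) (scalar_product b (shift u v h)))
    = (\<Sum>(s, t)\<in>UNIV. F s t)"
  \<comment> \<open>The inverse comes from Cramer's rule; since \<open>d * d = 1\<close>,
    multiplying by \<open>d\<close> replaces dividing by it.\<close>
  proof (rule sum.reindex_bij_witness[where
        i = "\<lambda>(s, t). (d * (\<delta> * s - \<beta> * t), d * (\<alpha> * t - \<gamma> * s))" and
        j = "\<lambda>h. (scalar_product a (shift u v h), scalar_product b (shift u v h))"], goal_cases)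
    case (1 h)
    have "d * (\<delta> * (fst h * \<alpha> + snd h * \<beta>) - \<beta> * (fst h * \<gamma> + snd h * \<delta>)) = d * d * fst h"
      "d * (\<alpha> * (fst h * \<gamma> + snd h * \<delta>) - \<gamma> * (fst h * \<alpha> + snd h * \<beta>)) = d * d * snd h"
      by (simp_all add: d_def algebra_simps)
    then show ?case
      by (simp add: scalar_product_shift ab dd)
  next
    case (3 z)
    obtain s t where [simp]: "z = (s, t)" by (cases z)
    have "d * (\<delta> * s - \<beta> * t) * \<alpha> + d * (\<alpha> * t - \<gamma> * s) * \<beta> = d * d * s"
      "d * (\<delta> * s - \<beta> * t) * \<gamma> + d * (\<alpha> * t - \<gamma> * s) * \<delta> = d * d * t"
      by (simp_all add: d_def algebra_simps)
    then show ?case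
      by (simp add: scalar_product_shift ab dd)
  qed auto
  then show ?thesis
    by (simp add: sum.cartesian_product UNIV_Times_UNIV[symmetric] del: UNIV_Times_UNIV)
qed

text \<open>A non-zero functional takes each of its three values at three of the nine
  points.\<close>

lemma sum_shift:
  fixes F :: "3 \<Rightarrow> real"
  assumes "slope u v a \<noteq> 0"
  shows "(\<Sum>h\<in>UNIV. F (scalar_product a (shift u v h))) = 3 * (\<Sum>s\<in>UNIV. F s)"
proof -
  obtain \<alpha> \<beta> where ab: "slope u v a = (\<alpha>, \<beta>)"
    by fastforce
  show ?thesis
    using three_cases[of \<alpha>] three_cases[of \<beta>] assms
    unfolding scalar_product_shift ab UNIV_Times_UNIV[symmetric] sum.cartesian_product'
    by (elim disjE) (simp_all add: sum_UNIV_3 zero_prod_def numerals_3)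
qed

section \<open>Plans made of translates of initial blocks\<close>

text \<open>Fixes an order of the pairs of a translation and an initial block, so that sums over
  block numbers become double sums over these pairs.\<close>

definition translate_index :: "'m block list \<Rightarrow> ((3 \<times> 3) \<times> nat) list"
  where "translate_index Bs = List.product (List.product [0, 1, 2] [0, 1, 2]) [0..<length Bs]"

definition translates :: "3 ^ 'm \<Rightarrow> 3 ^ 'm \<Rightarrow> 'm block list \<Rightarrow> 'm plan"
  where "translates u v Bs = map (\<lambda>(h, n). map ((+) (shift u v h)) (Bs ! n)) (translate_index Bs)"

lemma length_translate_index [simp]: "length (translate_index Bs) = 9 * length Bs"
  by (simp add: translate_index_def)

lemma length_translates [simp]: "length (translates u v Bs) = 9 * length Bs"
  by (simp add: translates_def)

lemma sum_translate_index:
  "(\<Sum>j<9 * length Bs. F (translate_index Bs ! j)) = (\<Sum>h\<in>UNIV. \<Sum>n<length Bs. F (h, n))"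
  for F :: "_ \<Rightarrow> 'c::comm_monoid_add"
proof -
  let ?L = "translate_index Bs"
  have dist: "distinct ?L"
    unfolding translate_index_def by (intro distinct_product) simp_all
  have "set [0, 1, 2 :: 3] = UNIV"
    using three_cases by auto
  then have "set ?L = UNIV \<times> {..<length Bs}"
    unfolding translate_index_def set_product
    by (simp only: UNIV_Times_UNIV set_upt atLeast0LessThan)
  then have bij: "bij_betw ((!) ?L) {..<9 * length Bs} (UNIV \<times> {..<length Bs})"
    using bij_betw_nth[OF dist refl refl] by simp
  show ?thesis
    by (simp add: sum.reindex_bij_betw[OF bij] sum.cartesian_product)
qed

lemma nth_translates:
  assumes "j < 9 * length Bs"
  shows "translates u v Bs ! j =
    (\<lambda>(h, n). map ((+) (shift u v h)) (Bs ! n)) (translate_index Bs ! j)"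
  using assms by (simp add: translates_def)

lemma sum_blocks_translates:
  fixes F :: "'m::finite block \<Rightarrow> 'c::comm_monoid_add"
  shows "(\<Sum>j<9 * length Bs. F (translates u v Bs ! j))
    = (\<Sum>h\<in>UNIV. \<Sum>n<length Bs. F (map ((+) (shift u v h)) (Bs ! n)))"
proof -
  have "(\<Sum>j<9 * length Bs. F (translates u v Bs ! j)) = (\<Sum>j<9 * length Bs.
      (\<lambda>(h, n). F (map ((+) (shift u v h)) (Bs ! n))) (translate_index Bs ! j))"
    by (intro sum.cong) (auto simp: nth_translates split: prod.splits)
  then show ?thesis
    by (simp only: sum_translate_index prod.case)
qed

lemma length_filter_sum: "length (filter P xs) = (\<Sum>i<length xs. of_bool (P (xs ! i)))"
proof -
  have "length (filter P xs) = (\<Sum>x\<leftarrow>xs. of_bool (P x))"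
    by (induction xs) auto
  then show ?thesis
    by (simp add: sum_list_sum_nth atLeast0LessThan)
qed

section \<open>Orthogonality through the block factor\<close>

text \<open>For any two runs \<open>x\<close>, \<open>y\<close>, exactly one \<open>h\<close> puts
  the translate of \<open>x\<close> at level \<alpha> of \<open>a\<close> and that of
  \<open>y\<close> at level \<beta> of \<open>b\<close>. So \<open>N\<close> counts the runs of the
  initial blocks, and the sum of products of \<open>L\<close> counts the ordered pairs of runs
  within an initial block, which is \<open>k\<close> times as much.\<close>

lemma orthogonal_translates:
  assumes k: "\<And>B. B \<in> set Bs \<Longrightarrow> length B = k"
    and indep: "det2 (slope u v a) (slope u v b) \<noteq> 0"
  shows "k * N_entry (translates u v Bs) a b \<alpha> \<beta> = (\<Sum>j<length (translates u v Bs).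
    L_entry (translates u v Bs) a \<alpha> j * L_entry (translates u v Bs) b \<beta> j)"
proof -
  define hit where "hit x y h = (of_bool
    (scalar_product a (shift u v h + x) = \<alpha> \<and> scalar_product b (shift u v h + y) = \<beta>) :: nat)"
    for x y h
  have once: "(\<Sum>h\<in>UNIV. hit x y h) = 1" for x y
  proof -
    have "(\<Sum>h\<in>UNIV. hit x y h)
      = (\<Sum>s\<in>UNIV. \<Sum>t\<in>UNIV. of_bool (s = \<alpha> - scalar_product a x \<and> t = \<beta> - scalar_product b y))"
      unfolding sum_shift_independent[OF indep, symmetric] hit_def
      by (intro sum.cong) (auto simp: scalar_product_add algebra_simps)
    also have "\<dots> = (\<Sum>s\<in>UNIV. if s = \<alpha> - scalar_product a x then
        (\<Sum>t\<in>UNIV. if t = \<beta> - scalar_product b y then 1 else 0) else 0)"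
      by (intro sum.cong) (auto intro!: sum.cong)
    also have "\<dots> = 1"
      by (simp add: sum.delta)
    finally show ?thesis .
  qed
  have "N_entry (translates u v Bs) a b \<alpha> \<beta> = (\<Sum>j<9 * length Bs. length (filter
      (\<lambda>x. scalar_product a x = \<alpha> \<and> scalar_product b x = \<beta>) (translates u v Bs ! j)))"
    by (simp add: N_entry_def filter_concat length_concat sum_list_sum_nth atLeast0LessThan o_def)
  \<comment> \<open>A single run must reach both levels, so only the diagonal pairs occur
    here.\<close>
  also have "\<dots> = (\<Sum>h\<in>UNIV. \<Sum>n<length Bs. \<Sum>i<length (Bs ! n). hit (Bs ! n ! i) (Bs ! n ! i) h)"
    unfolding hit_def length_filter_sum
    sum_blocks_translates[where F = "\<lambda>B. \<Sum>i<length B.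
      of_bool (scalar_product a (B ! i) = \<alpha> \<and> scalar_product b (B ! i) = \<beta>)"]
    by (intro sum.cong) auto
  also have "\<dots> = (\<Sum>n<length Bs. \<Sum>i<length (Bs ! n). 1)"
    by (simp only: sum.swap[of _ _ UNIV] once)
  also have "\<dots> = length Bs * k"
    by (simp add: k)
  finally have N: "N_entry (translates u v Bs) a b \<alpha> \<beta> = length Bs * k" .
  have "(\<Sum>j<9 * length Bs. L_entry (translates u v Bs) a \<alpha> j * L_entry (translates u v Bs) b \<beta> j)
    = (\<Sum>h\<in>UNIV. \<Sum>n<length Bs. \<Sum>i<length (Bs ! n). \<Sum>i'<length (Bs ! n).
        hit (Bs ! n ! i) (Bs ! n ! i') h)"
    unfolding L_entry_def sum_blocks_translates[where F = "\<lambda>B.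
      length (filter (\<lambda>x. scalar_product a x = \<alpha>) B) * length (filter (\<lambda>x. scalar_product b x = \<beta>) B)"]
    unfolding length_filter_sum sum_product hit_def of_bool_conj by (intro sum.cong) auto
  also have "\<dots> = (\<Sum>n<length Bs. \<Sum>i<length (Bs ! n). \<Sum>i'<length (Bs ! n). 1)"
    by (simp only: sum.swap[of _ _ UNIV] once)
  also have "\<dots> = length Bs * (k * k)"
    by (simp add: k)
  finally show ?thesis
    by (simp add: N)
qed

lemma slope_double: "slope u v (2 *s a) = (2 * fst (slope u v a), 2 * snd (slope u v a))"
  by (simp add: slope_def smult_scalar_product)

text \<open>The classes are the fibres of the map from an effect to its slope up to a non-zero
  scalar. Non-zero slopes from different fibres are independent; the given \<open>a\<close> and
  \<open>b\<close> ensure two classes.\<close>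

lemma inter_class_orthogonal_translates:
  fixes Bs :: "'m::finite block list"
  assumes k: "\<And>B. B \<in> set Bs \<Longrightarrow> length B = k"
    and S: "S \<subseteq> range effect"
    and slope: "\<And>a. effect a \<in> S \<Longrightarrow> slope u v a \<noteq> 0"
    and a: "effect a \<in> S" and b: "effect b \<in> S"
    and ab: "det2 (slope u v a) (slope u v b) \<noteq> 0"
  shows "inter_class_orthogonal k (translates u v Bs) S"
proof -
  \<comment> \<open>The slopes of both representatives together form a point of the projective line,
    whichever representative is taken.\<close>
  define \<sigma> where "\<sigma> A = slope u v ` A" for A
  define \<C> where "\<C> = (\<lambda>A. {B \<in> S. \<sigma> B = \<sigma> A}) ` S"
  have \<sigma>_effect: "\<sigma> (effect a) = {slope u v a, (2 * fst (slope u v a), 2 * snd (slope u v a))}" for a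
    by (simp add: \<sigma>_def effect_def slope_double)
  have "partition_on S \<C>"
    by (rule partition_onI) (auto simp: \<C>_def disjnt_def)
  moreover have "2 \<le> card \<C>"
  proof -
    have "\<sigma> (effect a) \<noteq> \<sigma> (effect b)"
      using ab by (auto simp: \<sigma>_effect doubleton_eq_iff det2_def mult.commute)
    then have "{B \<in> S. \<sigma> B = \<sigma> (effect a)} \<noteq> {B \<in> S. \<sigma> B = \<sigma> (effect b)}"
      using a by auto
    then have two: "card {{B \<in> S. \<sigma> B = \<sigma> (effect a)}, {B \<in> S. \<sigma> B = \<sigma> (effect b)}} = 2"
      by simp
    have sub: "{{B \<in> S. \<sigma> B = \<sigma> (effect a)}, {B \<in> S. \<sigma> B = \<sigma> (effect b)}} \<subseteq> \<C>"
      using a b by (auto simp: \<C>_def)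
    show ?thesis
      using card_mono[OF _ sub] unfolding two by (simp add: \<C>_def)
  qed
  moreover have "orthogonal_effects k (translates u v Bs) A B"
    if CD: "C \<in> \<C>" "D \<in> \<C>" "C \<noteq> D" "A \<in> C" "B \<in> D" for C D A B
    unfolding orthogonal_effects_def
  proof (intro ballI allI)
    fix a b \<alpha> \<beta>
    assume ab: "a \<in> A" "b \<in> B"
    have fibre: "Y = {B \<in> S. \<sigma> B = \<sigma> X} \<and> X \<in> S" if "Y \<in> \<C>" "X \<in> Y" for X Y
      using that by (auto simp: \<C>_def)
    have AB: "A \<in> S" "B \<in> S" "\<sigma> A \<noteq> \<sigma> B"
      using fibre[OF CD(1,4)] fibre[OF CD(2,5)] CD(3) by auto
    have "effect x = X" if X: "X \<in> S" "x \<in> X" for x X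
    proof -
      obtain y where "X = effect y"
        using S X(1) by blast
      then show ?thesis
        using X(2) by (metis in_effect_iff)
    qed
    then have eff: "effect a = A" "effect b = B"
      using AB ab by blast+
    then have nz: "slope u v a \<noteq> 0" "slope u v b \<noteq> 0"
      using slope AB by auto
    have "det2 (slope u v a) (slope u v b) \<noteq> 0"
    proof
      assume "det2 (slope u v a) (slope u v b) = 0"
      from det2_eq_0[OF this nz] have "\<sigma> (effect a) = \<sigma> (effect b)"
        by (cases "slope u v a") (auto simp: \<sigma>_effect numerals_3)
      then show False
        using AB eff by simp
    qed
    then show "k * N_entry (translates u v Bs) a b \<alpha> \<beta> = (\<Sum>j<length (translates u v Bs).
        L_entry (translates u v Bs) a \<alpha> j * L_entry (translates u v Bs) b \<beta> j)"
      by (intro orthogonal_translates k)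
  qed
  ultimately show ?thesis
    unfolding inter_class_orthogonal_def by blast
qed

section \<open>Estimability from weights on the initial blocks\<close>

lemma sum_add_3: "(\<Sum>t\<in>UNIV. f (c + t)) = (\<Sum>t\<in>UNIV. f t)"
  for f :: "3 \<Rightarrow> 'a::comm_monoid_add"
  by (rule sum.reindex_bij_witness[where i = "\<lambda>t. t - c" and j = "\<lambda>t. c + t"]) auto

text \<open>The values \<open>s\<close> of \<open>a'\<close> and \<open>t\<close> of
  \<open>b'\<close> on the plane vary independently. Summing over \<open>t\<close> first makes the
  \<phi>-factor the same for all runs of a block, leaving the vanishing weight sum of that
  block.\<close>

lemma sum_weights_independent:
  fixes Bs :: "'m::finite block list" and g :: "nat \<Rightarrow> nat \<Rightarrow> 3 \<Rightarrow> real"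
  assumes "\<And>n s. n < length Bs \<Longrightarrow> (\<Sum>i<length (Bs ! n). g n i s) = 0"
    and "det2 (slope u v a) (slope u v b) \<noteq> 0"
  shows "(\<Sum>h\<in>UNIV. \<Sum>n<length Bs. \<Sum>i<length (Bs ! n). g n i (scalar_product a (shift u v h)) *
    \<phi> (scalar_product b (shift u v h + Bs ! n ! i))) = 0"
proof -
  have "(\<Sum>h\<in>UNIV. \<Sum>n<length Bs. \<Sum>i<length (Bs ! n). g n i (scalar_product a (shift u v h)) *
      \<phi> (scalar_product b (shift u v h + Bs ! n ! i)))
    = (\<Sum>s\<in>UNIV. \<Sum>t\<in>UNIV. \<Sum>n<length Bs. \<Sum>i<length (Bs ! n).
        g n i s * \<phi> (scalar_product b (Bs ! n ! i) + t))"
    unfolding sum_shift_independent[OF assms(2), symmetric]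
    by (simp add: scalar_product_add add.commute)
  also have "\<dots> = (\<Sum>s\<in>UNIV. \<Sum>n<length Bs. \<Sum>i<length (Bs ! n). \<Sum>t\<in>UNIV.
        g n i s * \<phi> (scalar_product b (Bs ! n ! i) + t))"
    by (simp only: sum.swap[of _ "{..<_}" UNIV])
  also have "\<dots> = (\<Sum>s\<in>UNIV. \<Sum>n<length Bs. (\<Sum>i<length (Bs ! n). g n i s) * (\<Sum>t\<in>UNIV. \<phi> t))"
    by (simp only: sum_distrib_left[symmetric] sum_distrib_right sum_add_3)
  also have "\<dots> = 0"
    by (simp add: assms(1))
  finally show ?thesis .
qed

text \<open>Here \<open>b'\<close> and \<open>a'\<close> agree on the plane, so collecting the terms
  with equal level \<open>t\<close> of \<open>b\<close> gives the coefficient of \<phi>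
  \<open>t\<close>. The factor 3 is the multiplicity of each value on the plane.\<close>

lemma sum_weights_parallel:
  fixes Bs :: "'m::finite block list" and g :: "nat \<Rightarrow> nat \<Rightarrow> 3 \<Rightarrow> real"
  assumes "slope u v b = slope u v a" "slope u v a \<noteq> 0"
  shows "(\<Sum>h\<in>UNIV. \<Sum>n<length Bs. \<Sum>i<length (Bs ! n). g n i (scalar_product a (shift u v h)) *
      \<phi> (scalar_product b (shift u v h + Bs ! n ! i)))
    = 3 * (\<Sum>t\<in>UNIV. (\<Sum>n<length Bs. \<Sum>i<length (Bs ! n).
        g n i (t - scalar_product b (Bs ! n ! i))) * \<phi> t)"
proof -
  have ba: "scalar_product b (shift u v h) = scalar_product a (shift u v h)" for h
    by (simp add: scalar_product_shift assms(1))
  have reindex: "(\<Sum>s\<in>UNIV. g n i s * \<phi> (c + s)) = (\<Sum>t\<in>UNIV. g n i (t - c) * \<phi> t)" for n i c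
    using sum_add_3[of "\<lambda>t. g n i (t - c) * \<phi> t" c] by simp
  have "(\<Sum>h\<in>UNIV. \<Sum>n<length Bs. \<Sum>i<length (Bs ! n). g n i (scalar_product a (shift u v h)) *
      \<phi> (scalar_product b (shift u v h + Bs ! n ! i)))
    = 3 * (\<Sum>s\<in>UNIV. \<Sum>n<length Bs. \<Sum>i<length (Bs ! n).
        g n i s * \<phi> (scalar_product b (Bs ! n ! i) + s))"
    unfolding sum_shift[OF assms(2), symmetric]
    by (simp add: scalar_product_add ba add.commute)
  also have "(\<Sum>s\<in>UNIV. \<Sum>n<length Bs. \<Sum>i<length (Bs ! n).
        g n i s * \<phi> (scalar_product b (Bs ! n ! i) + s))
    = (\<Sum>n<length Bs. \<Sum>i<length (Bs ! n). \<Sum>s\<in>UNIV.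
        g n i s * \<phi> (scalar_product b (Bs ! n ! i) + s))"
    by (simp only: sum.swap[of _ "{..<_}" UNIV])
  also have "\<dots> = (\<Sum>n<length Bs. \<Sum>i<length (Bs ! n). \<Sum>t\<in>UNIV.
        g n i (t - scalar_product b (Bs ! n ! i)) * \<phi> t)"
    by (simp only: reindex)
  also have "\<dots> = (\<Sum>t\<in>UNIV. (\<Sum>n<length Bs. \<Sum>i<length (Bs ! n).
        g n i (t - scalar_product b (Bs ! n ! i))) * \<phi> t)"
    by (simp only: sum_distrib_right sum.swap[of _ "{..<_}" UNIV])
  finally show ?thesis .
qed

text \<open>Reduces estimability to a dual system within one class: zero sums over blocks remove
  \<mu> and the block effects, independence removes the other classes, and the last condition keeps
  only the wanted contrast. It suffices to treat vectors \<open>b\<close> with exactly the slope of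
  \<open>a\<close>, since each effect of the class has such a representative.\<close>

lemma estimates_translates:
  fixes Bs :: "'m::finite block list"
  assumes S: "S \<subseteq> range effect"
    and slope: "\<And>a. effect a \<in> S \<Longrightarrow> slope u v a \<noteq> 0"
    and weights: "\<And>a l. effect a \<in> S \<Longrightarrow> (\<Sum>t\<in>UNIV. l t) = 0 \<Longrightarrow>
      \<exists>g :: nat \<Rightarrow> nat \<Rightarrow> 3 \<Rightarrow> real.
        (\<forall>n<length Bs. \<forall>s. (\<Sum>i<length (Bs ! n). g n i s) = 0) \<and>
        (\<forall>b t. effect b \<in> S \<longrightarrow> slope u v b = slope u v a \<longrightarrow>
          (\<Sum>n<length Bs. \<Sum>i<length (Bs ! n). g n i (t - scalar_product b (Bs ! n ! i)))
            = (if b = a then l t else 0))"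
  shows "estimates (translates u v Bs) S"
  unfolding estimates_def
proof (intro allI impI ballI)
  fix r A and l :: "3 \<Rightarrow> real"
  assume r: "\<forall>A\<in>S. r A \<in> A" and A: "A \<in> S" and l: "(\<Sum>t\<in>UNIV. l t) = 0"
  have eff: "effect (r B) = B" if B: "B \<in> S" for B
  proof -
    obtain b where b: "B = effect b"
      using S B by blast
    then show ?thesis
      using r B by (metis in_effect_iff)
  qed
  define a where "a = r A"
  have aA: "effect a = A"
    by (simp add: a_def eff A)
  obtain g :: "nat \<Rightarrow> nat \<Rightarrow> 3 \<Rightarrow> real" where
    g0: "\<And>n s. n < length Bs \<Longrightarrow> (\<Sum>i<length (Bs ! n). g n i s) = 0" and
    g: "\<And>b t. effect b \<in> S \<Longrightarrow> slope u v b = slope u v a \<Longrightarrow>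
          (\<Sum>n<length Bs. \<Sum>i<length (Bs ! n). g n i (t - scalar_product b (Bs ! n ! i)))
            = (if b = a then l t else 0)"
    using weights[of a l, unfolded aA, OF A l] by blast
  let ?P = "translates u v Bs"
  \<comment> \<open>Division by 3 offsets the factor in \<open>sum_weights_parallel\<close>.\<close>
  define w where "w = (\<lambda>(h, n) i. g n i (scalar_product a (shift u v h)) / 3)"
  define c where "c j = w (translate_index Bs ! j)" for j
  have len: "length (?P ! j) = length (Bs ! snd (translate_index Bs ! j))"
    and nth: "i < length (?P ! j) \<Longrightarrow> ?P ! j ! i =
      (\<lambda>(h, n). shift u v h + Bs ! n ! i) (translate_index Bs ! j)"
    if "j < 9 * length Bs" for i j
    using that by (auto simp: nth_translates split: prod.splits)
  have snd_index: "snd (translate_index Bs ! j) < length Bs" if "j < 9 * length Bs" for j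
  proof -
    have "translate_index Bs ! j \<in> set (translate_index Bs)"
      using that by (intro nth_mem) simp
    then show ?thesis
      by (auto simp: translate_index_def)
  qed
  have c0: "(\<Sum>i<length (?P ! j). c j i) = 0" if "j < 9 * length Bs" for j
    using g0[OF snd_index[OF that]]
    by (simp add: len[OF that] c_def w_def case_prod_beta sum_divide_distrib[symmetric])
  have effects: "(\<Sum>j<9 * length Bs. \<Sum>i<length (?P ! j). c j i * \<phi> (scalar_product (r B) (?P ! j ! i)))
    = (if B = A then \<Sum>t\<in>UNIV. l t * \<phi> t else 0)" (is "?T = _") if B: "B \<in> S" for B \<phi>
  proof -
    have "?T = (\<Sum>j<9 * length Bs. (\<lambda>(h, n). \<Sum>i<length (Bs ! n). w (h, n) i *
        \<phi> (scalar_product (r B) (shift u v h + Bs ! n ! i))) (translate_index Bs ! j))"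
      by (intro sum.cong refl) (auto simp: nth len c_def split: prod.splits intro!: sum.cong)
    also have "\<dots> = (\<Sum>h\<in>UNIV. \<Sum>n<length Bs. \<Sum>i<length (Bs ! n).
        g n i (scalar_product a (shift u v h)) *
        \<phi> (scalar_product (r B) (shift u v h + Bs ! n ! i))) / 3"
      unfolding sum_translate_index by (simp add: w_def sum_divide_distrib)
    finally have T: "?T = \<dots>" .
    show ?thesis
    proof (cases "det2 (slope u v a) (slope u v (r B)) = 0")
      case False
      then have "B \<noteq> A"
        by (auto simp: a_def det2_def mult.commute)
      then show ?thesis
        using sum_weights_independent[of Bs g, OF g0 False] by (simp add: T)
    next
      case True
      have nz: "slope u v a \<noteq> 0" "slope u v (r B) \<noteq> 0"
        using slope A B by (auto simp: aA eff)
      show ?thesis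
      proof (cases "slope u v (r B) = slope u v a")
        case same: True
        have "r B = a \<longleftrightarrow> B = A"
          by (metis a_def aA eff[OF B])
        then show ?thesis
          using g[of "r B"] B eff[OF B]
          by (simp add: T sum_weights_parallel[OF same nz(1)] same)
      next
        case False
        \<comment> \<open>The chosen representative has twice the slope of \<open>a\<close>, so the
          other one is used and the levels are relabelled by doubling.\<close>
        let ?b = "2 *s r B"
        have same: "slope u v ?b = slope u v a"
          using det2_eq_0[OF True nz] False by (auto simp: slope_double numerals_3)
        have b: "effect ?b = B"
          using eff[OF B] by (auto simp: effect_def)
        have "B \<noteq> A"
          using False by (auto simp: a_def)
        then have "?b \<noteq> a"
          using b aA by auto
        have \<phi>: "\<phi> (scalar_product (r B) x) = \<phi> (2 * scalar_product ?b x)" for x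
          by (simp add: smult_scalar_product numerals_3)
        show ?thesis
          unfolding T unfolding \<phi> sum_weights_parallel[OF same nz(1), where \<phi> = "\<lambda>t. \<phi> (2 * t)"]
          using g[of ?b] same b B \<open>B \<noteq> A\<close> \<open>?b \<noteq> a\<close> by simp
      qed
    qed
  qed
  have "(\<Sum>j<length ?P. \<Sum>i<length (?P ! j). c j i * expected_response S r \<mu> \<beta> \<theta> j (?P ! j ! i))
    = (\<Sum>t\<in>UNIV. l t * \<theta> A t)" for \<mu> \<beta> \<theta>
  proof -
    have "(\<Sum>j<length ?P. \<Sum>i<length (?P ! j). c j i * expected_response S r \<mu> \<beta> \<theta> j (?P ! j ! i))
      = (\<Sum>j<9 * length Bs. (\<Sum>i<length (?P ! j). c j i) * (\<mu> + \<beta> j) +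
          (\<Sum>B\<in>S. \<Sum>i<length (?P ! j). c j i * \<theta> B (scalar_product (r B) (?P ! j ! i))))"
      unfolding expected_response_def length_translates
      by (intro sum.cong refl, subst sum.swap)
        (simp add: distrib_left sum.distrib sum_distrib_left sum_distrib_right)
    also have "\<dots> = (\<Sum>B\<in>S. \<Sum>j<9 * length Bs. \<Sum>i<length (?P ! j).
        c j i * \<theta> B (scalar_product (r B) (?P ! j ! i)))"
      by (subst sum.swap) (simp add: c0)
    also have "\<dots> = (\<Sum>B\<in>S. if B = A then \<Sum>t\<in>UNIV. l t * \<theta> A t else 0)"
      by (intro sum.cong refl) (auto simp: effects)
    also have "\<dots> = (\<Sum>t\<in>UNIV. l t * \<theta> A t)"
      using A by simp
    finally show ?thesis .
  qed
  then show "estimable ?P S r (\<lambda>\<mu> \<beta> \<theta>. \<Sum>t\<in>UNIV. l t * \<theta> A t)"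
    unfolding estimable_def by blast
qed

section \<open>The tetracode and the classes of low-order effects\<close>

lemma vector_4 [simp]:
  "(vector [w, x, y, z] :: 'a::zero ^ 4) $ 1 = w"
  "(vector [w, x, y, z] :: 'a::zero ^ 4) $ 2 = x"
  "(vector [w, x, y, z] :: 'a::zero ^ 4) $ 3 = y"
  "(vector [w, x, y, z] :: 'a::zero ^ 4) $ 4 = z"
  unfolding vector_def by simp_all

lemma scalar_product_vector_4:
  "scalar_product a (vector [w, x, y, z]) = a $ 1 * w + a $ 2 * x + a $ 3 * y + a $ 4 * z"
  for a :: "'a::semiring_1 ^ 4"
  by (simp add: scalar_product_def sum_4)

definition weight :: "3 ^ 'm \<Rightarrow> nat"
  where "weight a = card {i. a $ i \<noteq> 0}"

lemma weight_4: "weight a =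
    of_bool (a $ 1 \<noteq> 0) + of_bool (a $ 2 \<noteq> 0) + of_bool (a $ 3 \<noteq> 0) + of_bool (a $ 4 \<noteq> 0)"
  for a :: "3 ^ 4"
proof -
  have "weight a = (\<Sum>i\<in>UNIV. of_bool (a $ i \<noteq> 0))"
    by (simp add: weight_def)
  then show ?thesis
    by (simp only: sum_4)
qed

lemma weight_double: "weight (2 *s a) = weight a"
proof -
  have "2 * x = 0 \<longleftrightarrow> x = 0" for x :: 3
    using three_cases[of x] by auto
  then show ?thesis
    by (simp add: weight_def)
qed

abbreviation (input) low_effects :: "(3 ^ 4) set set"
  where "low_effects \<equiv> main_effects \<union> two_factor_interactions"

lemma effect_in_low_effects_iff: "effect b \<in> low_effects \<longleftrightarrow> weight b \<in> {1, 2}"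
proof
  assume "effect b \<in> low_effects"
  then obtain a where "effect b = effect a" "weight a \<in> {1, 2}"
    unfolding main_effects_def two_factor_interactions_def weight_def by blast
  moreover have "b \<in> effect a"
    using calculation by (simp add: in_effect_iff)
  ultimately show "weight b \<in> {1, 2}"
    by (auto simp: effect_def weight_double)
qed (auto simp: main_effects_def two_factor_interactions_def weight_def)

definition gen_u :: "3 ^ 4"
  where "gen_u = vector [1, 1, 1, 0]"

definition gen_v :: "3 ^ 4"
  where "gen_v = vector [0, 1, 2, 1]"

lemma slope_gen: "slope gen_u gen_v a = (a $ 1 + a $ 2 + a $ 3, a $ 2 + a $ 3 * 2 + a $ 4)"
  by (simp add: slope_def gen_u_def gen_v_def scalar_product_vector_4)

text \<open>The difference of \<open>b\<close> and \<open>a\<close> annihilates the code, and by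
  self-duality it is a codeword \<open>p *s gen_u + q *s gen_v\<close>.\<close>

lemma slope_eqE:
  assumes "slope gen_u gen_v b = slope gen_u gen_v a"
  obtains p q where "b $ 1 = a $ 1 + p" "b $ 2 = a $ 2 + (p + q)"
    "b $ 3 = a $ 3 + (p + 2 * q)" "b $ 4 = a $ 4 + q"
proof -
  define p q where "p = b $ 1 - a $ 1" and "q = b $ 4 - a $ 4"
  define y z where "y = b $ 2 - a $ 2" and "z = b $ 3 - a $ 3"
  have "p + y + z = (b $ 1 + b $ 2 + b $ 3) - (a $ 1 + a $ 2 + a $ 3)"
    "y + z * 2 + q = (b $ 2 + b $ 3 * 2 + b $ 4) - (a $ 2 + a $ 3 * 2 + a $ 4)"
    by (simp_all add: p_def q_def y_def z_def algebra_simps)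
  then have "p + y + z = 0" "y + z * 2 + q = 0"
    using assms by (simp_all only: slope_gen prod.inject diff_self)
  then have "y = p + q \<and> z = p + 2 * q"
    using three_cases[of p] three_cases[of q] three_cases[of y] three_cases[of z]
    by (elim disjE) (simp_all add: numerals_3)
  then show ?thesis
    by (intro that[of p q]) (simp_all add: p_def q_def y_def z_def algebra_simps)
qed

text \<open>A vector of slope 0 is a codeword, and non-zero codewords have weight 3.\<close>

lemma slope_gen_nonzero:
  assumes "weight a \<in> {1, 2}"
  shows "slope gen_u gen_v a \<noteq> 0"
proof
  assume "slope gen_u gen_v a = 0"
  then have "slope gen_u gen_v a = slope gen_u gen_v 0"
    by (simp add: slope_gen zero_prod_def)
  then obtain p q where pq: "a $ 1 = p" "a $ 2 = p + q" "a $ 3 = p + 2 * q" "a $ 4 = q"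
    by (auto elim!: slope_eqE)
  show False
    using three_cases[of p] three_cases[of q] assms unfolding weight_4 pq
    by (elim disjE) (simp_all add: numerals_3)
qed

text \<open>Away from coordinate \<open>i\<close> each vector has at most one non-zero entry, so
  they differ in at most two places; a codeword that short is 0.\<close>

lemma same_slope_unique:
  assumes "weight a \<in> {1, 2}" "weight b \<in> {1, 2}" "slope gen_u gen_v b = slope gen_u gen_v a"
    and "a $ i \<noteq> 0" "b $ i = a $ i" "i = 1 \<or> i = 2"
  shows "b = a"
proof -
  obtain p q where pq: "b $ 1 = a $ 1 + p" "b $ 2 = a $ 2 + (p + q)"
      "b $ 3 = a $ 3 + (p + 2 * q)" "b $ 4 = a $ 4 + q"
    using assms(3) by (rule slope_eqE)
  show ?thesis
    using assms(6)
  proof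
    assume i: "i = 1"
    then have p: "p = 0"
      using assms(5) pq(1) by simp
    show ?thesis
      using three_cases[of q] three_cases[of "a $ 2"] three_cases[of "a $ 3"]
        three_cases[of "a $ 4"] assms(1,2,4)
      unfolding vec_eq_iff[of b a] forall_4 weight_4 pq p i
      by (elim disjE) (simp_all add: numerals_3)
  next
    assume i: "i = 2"
    then have "p + q = 0"
      using assms(5) pq(2) by simp
    then have q: "q = 2 * p"
      using three_cases[of p] three_cases[of q] by (elim disjE) (simp_all add: numerals_3)
    show ?thesis
      using three_cases[of p] three_cases[of "a $ 1"] three_cases[of "a $ 3"]
        three_cases[of "a $ 4"] assms(1,2,4)
      unfolding vec_eq_iff[of b a] forall_4 weight_4 pq q i
      by (elim disjE) (simp_all add: numerals_3)
  qed
qed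

text \<open>Describes the rest of a class whose given member involves neither factor 1 nor 2, by the
  coordinates that the differences along e3 or e4 and the lines along e1 or e2 detect. All are found
  by adding the nine codewords and discarding sums of weight above 2.\<close>

lemma same_slope_axis:
  assumes "weight b \<in> {1, 2}" "slope gen_u gen_v b = slope gen_u gen_v a"
    and "a $ 1 = 0" "a $ 2 = 0"
  shows "a $ 4 = 0 \<Longrightarrow> a $ 3 \<noteq> 0 \<Longrightarrow> b = a \<or> b $ 3 = 0" (is "PROP ?A")
    and "a $ 3 = 0 \<Longrightarrow> a $ 4 \<noteq> 0 \<Longrightarrow> b = a \<or> b $ 4 = 0" (is "PROP ?B")
    and "a $ 4 = a $ 3 \<Longrightarrow> a $ 3 \<noteq> 0 \<Longrightarrow> b = a \<or>
      b $ 3 = 0 \<and> b $ 2 \<in> {0, a $ 3} \<or> b $ 2 = 2 * a $ 3 \<and> b $ 3 = 2 * a $ 3" (is "PROP ?C")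
    and "a $ 4 = 2 * a $ 3 \<Longrightarrow> a $ 3 \<noteq> 0 \<Longrightarrow> b = a \<or>
      b $ 3 = 0 \<and> b $ 1 \<in> {0, a $ 3} \<or> b $ 1 = 2 * a $ 3 \<and> b $ 3 = 2 * a $ 3" (is "PROP ?D")
proof -
  obtain p q where pq: "b $ 1 = a $ 1 + p" "b $ 2 = a $ 2 + (p + q)"
      "b $ 3 = a $ 3 + (p + 2 * q)" "b $ 4 = a $ 4 + q"
    using assms(2) by (rule slope_eqE)
  show "PROP ?A" "PROP ?B" "PROP ?C" "PROP ?D"
    using three_cases[of p] three_cases[of q] three_cases[of "a $ 3"] three_cases[of "a $ 4"]
      assms(1)
    unfolding vec_eq_iff[of b a] forall_4 weight_4 pq assms(3,4)
    by (elim disjE; simp add: numerals_3)+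
qed

section \<open>The initial blocks and their weights\<close>

definition initial_blocks :: "4 block list"
  where "initial_blocks =
    [[vector [0, 0, 0, 0], vector [1, 0, 0, 0], vector [2, 0, 0, 0], vector [0, 0, 1, 0]],
     [vector [0, 0, 0, 0], vector [0, 1, 0, 0], vector [0, 2, 0, 0], vector [0, 0, 0, 1]]]"

lemma sum_initial_blocks:
  fixes G :: "nat \<Rightarrow> nat \<Rightarrow> 3 \<Rightarrow> real"
  shows "(\<Sum>n<length initial_blocks. \<Sum>i<length (initial_blocks ! n).
      G n i (t - scalar_product b (initial_blocks ! n ! i)))
    = G 0 0 t + G 0 1 (t - b $ 1) + G 0 2 (t - b $ 1 * 2) + G 0 3 (t - b $ 3)
      + (G 1 0 t + G 1 1 (t - b $ 2) + G 1 2 (t - b $ 2 * 2) + G 1 3 (t - b $ 4))"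
  by (simp add: initial_blocks_def scalar_product_vector_4 eval_nat_numeral)

lemma sum_initial_block:
  fixes G :: "nat \<Rightarrow> nat \<Rightarrow> real"
  assumes "n < length initial_blocks"
  shows "(\<Sum>i<length (initial_blocks ! n). G n i) = G n 0 + G n 1 + G n 2 + G n 3"
proof -
  have "length (initial_blocks ! n) = 4"
    using assms by (auto simp: initial_blocks_def less_Suc_eq)
  then show ?thesis
    by (simp add: eval_nat_numeral)
qed

text \<open>For \<open>x \<noteq> y\<close> the three arguments exhaust F. For \<open>x = y\<close>
  the sum is \<open>3 * l t\<close> instead, so a line singles out the members with a prescribed
  coefficient.\<close>

lemma contrast_line:
  fixes l :: "3 \<Rightarrow> real"
  assumes "(\<Sum>t\<in>UNIV. l t) = 0" "x \<noteq> y"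
  shows "l t + l (t - x + y) + l (t - x * 2 + 2 * y) = 0"
  using three_cases[of t] three_cases[of x] three_cases[of y] assms unfolding sum_UNIV_3
  by (elim disjE) (simp_all add: numerals_3)

text \<open>The values of \<open>l\<close> at \<open>t - c\<close>, \<open>t\<close>,
  \<open>t + c\<close> sum to 0, so this difference of differences is \<open>3 * l t\<close> before
  the division.\<close>

lemma contrast_difference:
  fixes l :: "3 \<Rightarrow> real"
  assumes "(\<Sum>t\<in>UNIV. l t) = 0" "c \<noteq> 0"
  shows "(l (t - c + c) - l (t - c)) / 3 - (l (t + c) - l t) / 3 = l t"
  using three_cases[of c] three_cases[of t] assms unfolding sum_UNIV_3
  by (elim disjE) (simp_all add: numerals_3 field_simps)

text \<open>
  Here \<open>y\<close> is the coefficient of factor 1 or 2 and \<open>z\<close> that of factor 3 in a member of the class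
  of an interaction of the factors 3 and 4.  The second summand removes the member with
  \<open>y = z = 2c\<close>, which also contributes to the differences along \<open>e\<^sub>3\<close>.
\<close>

lemma contrast_elimination:
  fixes l :: "3 \<Rightarrow> real"
  assumes "(\<Sum>t\<in>UNIV. l t) = 0" "c \<noteq> 0"
    and "z = 0 \<and> y \<in> {0, c} \<or> y = 2 * c \<and> z = 2 * c"
  shows "((l (t - z + c) - l (t - z)) - (l (t + c) - l t)
    + (l (t + c) + l (t - y) + l (t - y * 2 + 2 * c))) / 3 = 0"
proof -
  have l: "l 0 + l 1 + l 2 = 0"
    using assms(1) by (simp add: sum_UNIV_3)
  consider "z = 0" "y = 0" | "z = 0" "y = c" | "z = 2 * c" "y = 2 * c"
    using assms(3) by blast
  then show ?thesis
    using three_cases[of c] three_cases[of t] assms(2) l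
    by cases (elim disjE; simp add: numerals_3 field_simps)+
qed

text \<open>Solves the dual system case by case, according to the support of \<open>a\<close> and,
  when only factors 3 and 4 are involved, the ratio of their coefficients.\<close>

lemma weights_exist:
  fixes l :: "3 \<Rightarrow> real"
  assumes a: "weight a \<in> {1, 2}" and l: "(\<Sum>t\<in>UNIV. l t) = 0"
  shows "\<exists>g :: nat \<Rightarrow> nat \<Rightarrow> 3 \<Rightarrow> real.
    (\<forall>n<length initial_blocks. \<forall>s. (\<Sum>i<length (initial_blocks ! n). g n i s) = 0) \<and>
    (\<forall>b t. weight b \<in> {1, 2} \<longrightarrow> slope gen_u gen_v b = slope gen_u gen_v a \<longrightarrow>
      (\<Sum>n<length initial_blocks. \<Sum>i<length (initial_blocks ! n).
        g n i (t - scalar_product b (initial_blocks ! n ! i))) = (if b = a then l t else 0))"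
    (is ?goal)
proof -
  \<comment> \<open>The entry \<open>T s ! n ! i\<close> is the weight of run \<open>i\<close> of
    initial block \<open>n\<close> when \<open>a'h = s\<close>.\<close>
  have table: ?goal
    if block: "\<And>s. T s ! 0 ! 0 + T s ! 0 ! 1 + T s ! 0 ! 2 + T s ! 0 ! 3 = 0"
      "\<And>s. T s ! 1 ! 0 + T s ! 1 ! 1 + T s ! 1 ! 2 + T s ! 1 ! 3 = 0"
      and dual: "\<And>b t. weight b \<in> {1, 2} \<Longrightarrow> slope gen_u gen_v b = slope gen_u gen_v a \<Longrightarrow>
        T t ! 0 ! 0 + T (t - b $ 1) ! 0 ! 1 + T (t - b $ 1 * 2) ! 0 ! 2 + T (t - b $ 3) ! 0 ! 3
        + (T t ! 1 ! 0 + T (t - b $ 2) ! 1 ! 1 + T (t - b $ 2 * 2) ! 1 ! 2 + T (t - b $ 4) ! 1 ! 3)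
          = (if b = a then l t else 0)"
    for T :: "3 \<Rightarrow> real list list"
  proof (intro exI conjI allI impI)
    fix n s
    assume n: "n < length initial_blocks"
    then have "n = 0 \<or> n = 1"
      by (auto simp: initial_blocks_def)
    then show "(\<Sum>i<length (initial_blocks ! n). T s ! n ! i) = 0"
      unfolding sum_initial_block[OF n, where G = "\<lambda>n i. T s ! n ! i"]
      using block[of s] by (elim disjE) simp_all
  next
    fix b t
    assume b: "weight b \<in> {1, 2}" "slope gen_u gen_v b = slope gen_u gen_v a"
    show "(\<Sum>n<length initial_blocks. \<Sum>i<length (initial_blocks ! n).
        T (t - scalar_product b (initial_blocks ! n ! i)) ! n ! i) = (if b = a then l t else 0)"
      unfolding sum_initial_blocks[where G = "\<lambda>n i s. T s ! n ! i"] by (rule dual[OF b])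
  qed
  have line: "l s + l (s + c) + l (s + 2 * c) = 0" if "c \<noteq> 0" for s c
    using contrast_line[OF l, of 0 c s] that by simp
  have "a $ 3 \<noteq> 0 \<and> a $ 4 = 0 \<or> a $ 3 = 0 \<and> a $ 4 \<noteq> 0 \<or> a $ 3 \<noteq> 0 \<and> a $ 4 = a $ 3 \<or>
      a $ 3 \<noteq> 0 \<and> a $ 4 = 2 * a $ 3" if "a $ 1 = 0" "a $ 2 = 0"
    using three_cases[of "a $ 3"] three_cases[of "a $ 4"] a unfolding weight_4 that
    by (elim disjE) (simp_all add: numerals_3)
  then consider "a $ 1 \<noteq> 0" | "a $ 2 \<noteq> 0"
    | "a $ 1 = 0" "a $ 2 = 0" "a $ 4 = 0" "a $ 3 \<noteq> 0"
    | "a $ 1 = 0" "a $ 2 = 0" "a $ 3 = 0" "a $ 4 \<noteq> 0"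
    | "a $ 1 = 0" "a $ 2 = 0" "a $ 4 = a $ 3" "a $ 3 \<noteq> 0"
    | "a $ 1 = 0" "a $ 2 = 0" "a $ 4 = 2 * a $ 3" "a $ 3 \<noteq> 0"
    by blast
  then show ?thesis
  proof cases
    case 1
    show ?thesis
    \<comment> \<open>Each run of the line gets a third of \<open>l\<close> at its level of
      \<open>a\<close>; members whose first coefficient differs cancel, and no other member shares
      it.\<close>
    proof (rule table[of "\<lambda>s. [[l s / 3, l (s + a $ 1) / 3, l (s + 2 * a $ 1) / 3, 0],
        [0, 0, 0, 0]]"], goal_cases)
      case (3 b t)
      then show ?case
        using contrast_line[OF l, of "b $ 1" "a $ 1" t] same_slope_unique[OF a 3 1]
        by (cases "b $ 1 = a $ 1") (auto simp: algebra_simps add_divide_distrib[symmetric])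
    qed (use line[OF 1] in \<open>simp_all add: add_divide_distrib[symmetric]\<close>)
  next
    case 2
    show ?thesis
    proof (rule table[of "\<lambda>s. [[0, 0, 0, 0],
        [l s / 3, l (s + a $ 2) / 3, l (s + 2 * a $ 2) / 3, 0]]"], goal_cases)
      case (3 b t)
      then show ?case
        using contrast_line[OF l, of "b $ 2" "a $ 2" t] same_slope_unique[OF a 3 2]
        by (cases "b $ 2 = a $ 2") (auto simp: algebra_simps add_divide_distrib[symmetric])
    qed (use line[OF 2] in \<open>simp_all add: add_divide_distrib[symmetric]\<close>)
  next
    case c: 3
    define D where "D t = (l (t + a $ 3) - l t) / 3" for t
    show ?thesis
    \<comment> \<open>The runs 0 and e3 contribute \<open>D (t - b $ 3) - D t\<close>, which
      vanishes when \<open>b $ 3 = 0\<close>.\<close>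
    proof (rule table[of "\<lambda>s. [[- D s, 0, 0, D s], [0, 0, 0, 0]]"], goal_cases)
      case (3 b t)
      then show ?case
        using contrast_difference[OF l c(4), folded D_def] same_slope_axis(1)[OF 3 c] c
        by (cases "b = a") auto
    qed simp_all
  next
    case c: 4
    define D where "D t = (l (t + a $ 4) - l t) / 3" for t
    show ?thesis
    proof (rule table[of "\<lambda>s. [[0, 0, 0, 0], [- D s, 0, 0, D s]]"], goal_cases)
      case (3 b t)
      then show ?case
        using contrast_difference[OF l c(4), folded D_def] same_slope_axis(2)[OF 3 c] c
        by (cases "b = a") auto
    qed simp_all
  next
    case c: 5
    define D where "D t = (l (t + a $ 3) - l t) / 3" for t
    show ?thesis
    \<comment> \<open>The difference along e3 also picks up the interaction of factors 2 and 3 in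
      the class. The weights on the line along e2 act only on members with
      \<open>b $ 2 = 2 * a $ 3\<close> and cancel it.\<close>
    proof (rule table[of "\<lambda>s. [[- D s, 0, 0, D s],
        [l (s + a $ 3) / 3, l s / 3, l (s + 2 * a $ 3) / 3, 0]]"], goal_cases)
      case (3 b t)
      have "D (t - b $ 3) - D t + (l (t + a $ 3) + l (t - b $ 2) + l (t - b $ 2 * 2 + 2 * a $ 3)) / 3
        = (if b = a then l t else 0)"
        using contrast_difference[OF l c(4), of t] line[OF c(4), of t]
          contrast_elimination[OF l c(4), of "b $ 3" "b $ 2" t] same_slope_axis(3)[OF 3 c] c
        by (cases "b = a") (auto simp: D_def add_divide_distrib diff_divide_distrib)
      then show ?case
        by (simp add: add_divide_distrib)
    qed (use line[OF c(4)] in \<open>simp_all add: add_divide_distrib[symmetric] add.commute\<close>)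
  next
    case c: 6
    define D where "D t = (l (t + a $ 3) - l t) / 3" for t
    show ?thesis
    \<comment> \<open>Now the member to eliminate involves factors 1 and 3, so the line lies in the
      first block too and both weights of the run 0 add up.\<close>
    proof (rule table[of "\<lambda>s. [[l (s + a $ 3) / 3 - D s, l s / 3, l (s + 2 * a $ 3) / 3, D s],
        [0, 0, 0, 0]]"], goal_cases)
      case (3 b t)
      have "D (t - b $ 3) - D t + (l (t + a $ 3) + l (t - b $ 1) + l (t - b $ 1 * 2 + 2 * a $ 3)) / 3
        = (if b = a then l t else 0)"
        using contrast_difference[OF l c(4), of t] line[OF c(4), of t]
          contrast_elimination[OF l c(4), of "b $ 3" "b $ 1" t] same_slope_axis(4)[OF 3 c] c
        by (cases "b = a") (auto simp: D_def add_divide_distrib diff_divide_distrib)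
      then show ?case
        by (simp add: add_divide_distrib)
    qed (use line[OF c(4)] in \<open>simp_all add: add_divide_distrib[symmetric] add.commute\<close>)
  qed
qed

theorem theorem5p2:
  shows "\<exists>P :: 4 plan.
    length P = 18 \<and> (\<forall>B\<in>set P. length B = 4) \<and>
    inter_class_orthogonal 4 P (main_effects \<union> two_factor_interactions) \<and>
    estimates P (main_effects \<union> two_factor_interactions)"
proof (intro exI conjI)
  let ?P = "translates gen_u gen_v initial_blocks"
  have S: "low_effects \<subseteq> range effect"
    by (auto simp: main_effects_def two_factor_interactions_def)
  have nz: "slope gen_u gen_v a \<noteq> 0" if "effect a \<in> low_effects" for a
    using slope_gen_nonzero that unfolding effect_in_low_effects_iff .
  have four: "length B = 4" if "B \<in> set initial_blocks" for B
    using that by (auto simp: initial_blocks_def)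
  show "length ?P = 18"
    by (simp add: initial_blocks_def)
  show "\<forall>B\<in>set ?P. length B = 4"
    using four by (auto simp: translates_def translate_index_def)
  show "inter_class_orthogonal 4 ?P low_effects"
  proof (rule inter_class_orthogonal_translates[OF four S nz])
    show "effect (vector [1, 0, 0, 0]) \<in> low_effects" "effect (vector [0, 1, 0, 0]) \<in> low_effects"
      unfolding effect_in_low_effects_iff by (simp_all add: weight_4)
    \<comment> \<open>The slopes are \<open>(1, 0)\<close> and \<open>(1, 1)\<close>, with
      determinant 1.\<close>
    show "det2 (slope gen_u gen_v (vector [1, 0, 0, 0])) (slope gen_u gen_v (vector [0, 1, 0, 0])) \<noteq> 0"
      by (simp add: slope_gen det2_def)
  qed
  show "estimates ?P low_effects"
    by (rule estimates_translates[OF S nz])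
      (use weights_exist in \<open>simp_all only: effect_in_low_effects_iff\<close>)
qed

end
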